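(* Let $X=\prod_{i=1}^n\{0,\dots,m_i\}$, $f\colon X\to X$, and $F=\beta\circ f\circ\beta^{-1}\circ\psi\colon\{0,1\}^m\to\{0,1\}^m$. (i) If for some $x\in X$ the local interaction graph $G_f(x)$ contains a positive (resp. negative) cycle, then there exists $y\in\{0,1\}^m$ with $\psi(y)=\beta(x)$ such that $G_F(y)$ contains a positive (resp. negative) cycle. (ii) If the global interaction graph $G_f$ contains a positive (resp. negative) cycle, then the global interaction graph $G_F$ contains a positive (resp. negative) cycle.
   Context: $m_i\ge1$, $m=\sum_i m_i$; coordinates of $\{0,1\}^m$ are indexed by $I=\{(i,j)\mid 1\le i\le n,\,1\le j\le m_i\}$. $\beta\colon X\to\{0,1\}^m$ is given by $\beta_{i,j}(x)=1$ iff $x_i\ge j$; $\mathcal{A}=\beta(X)$ and $\beta^{-1}$ denotes the inverse of $\beta\colon X\to\mathcal{A}$. $\psi\colon\{0,1\}^m\to\mathcal{A}$ is defined by $\psi_{i,j}(y)=1$ iff $\sum_{k=1}^{m_i}y_{i,k}\ge j$. $e^k$ is the $k$-th unit vector, $\mathrm{sign}(0)=0$. For a map $g\colon Y\to Y$, $Y$ a set of integer vectors with coordinates indexed by a finite set $J$, the local interaction graph $G_g(x)$ at $x\in Y$ has vertex set $J$ and an edge from $j$ to $i$ with sign $s=s_1\,\mathrm{sign}(g_i(x+s_1e^j)-g_i(x))$ whenever $s_1\in\{-1,1\}$, $x+s_1e^j\in Y$ and $s\ne0$. The global interaction graph $G_g$ has vertex set $J$ and an edge $j\to i$ of sign $s$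 iff some $G_g(x)$ has such an edge. Cycles are elementary directed cycles (loops allowed); the sign of a cycle is the product of the signs of its edges. *)

theory Defs
  imports "HOL-Library.FuncSet" "Graph_Theory.Arc_Walk"
begin

text \<open>
  A vector of integers with coordinates in a finite set J is an extensional
  function on J. Hence the vector obtained from x by adding s times the j-th unit vector is
  the update x(j := x j + s), for j in J.
\<close>

definition mv_space :: "nat \<Rightarrow> (nat \<Rightarrow> nat) \<Rightarrow> (nat \<Rightarrow> int) set" where
  "mv_space n m = (\<Pi>\<^sub>E i\<in>{1..n}. {0..int (m i)})"

definition bool_index :: "nat \<Rightarrow> (nat \<Rightarrow> nat) \<Rightarrow> (nat \<times> nat) set" where
  "bool_index n m = (SIGMA i:{1..n}. {1..m i})"

definition bool_space :: "nat \<Rightarrow> (nat \<Rightarrow> nat) \<Rightarrow> (nat \<times> nat \<Rightarrow> int) set" where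
  "bool_space n m = (\<Pi>\<^sub>E p\<in>bool_index n m. {0, 1})"

definition beta :: "nat \<Rightarrow> (nat \<Rightarrow> nat) \<Rightarrow> (nat \<Rightarrow> int) \<Rightarrow> (nat \<times> nat \<Rightarrow> int)" where
  "beta n m x = restrict (\<lambda>(i, j). if x i \<ge> int j then 1 else 0) (bool_index n m)"

definition psi :: "nat \<Rightarrow> (nat \<Rightarrow> nat) \<Rightarrow> (nat \<times> nat \<Rightarrow> int) \<Rightarrow> (nat \<times> nat \<Rightarrow> int)" where
  "psi n m y =
     restrict (\<lambda>(i, j). if (\<Sum>k = 1..m i. y (i, k)) \<ge> int j then 1 else 0) (bool_index n m)"

text \<open>
  A signed arc (j, s, i) runs from j to i and has sign s. Since the sign is part of the arc,
  a positive and a negative arc may run in parallel.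
\<close>

type_synonym 'j signed_arc = "'j \<times> int \<times> 'j"

definition arc_sign :: "'j signed_arc \<Rightarrow> int" where
  "arc_sign e = fst (snd e)"

definition signed_digraph :: "'j set \<Rightarrow> 'j signed_arc set \<Rightarrow> ('j, 'j signed_arc) pre_digraph" where
  "signed_digraph J E = \<lparr>verts = J, arcs = E, tail = fst, head = (\<lambda>e. snd (snd e))\<rparr>"

definition local_interaction_graph ::
  "'j set \<Rightarrow> ('j \<Rightarrow> int) set \<Rightarrow> (('j \<Rightarrow> int) \<Rightarrow> ('j \<Rightarrow> int)) \<Rightarrow> ('j \<Rightarrow> int)
    \<Rightarrow> ('j, 'j signed_arc) pre_digraph" where
  "local_interaction_graph J Y g x = signed_digraph J
     {(j, s, i) | j s i. j \<in> J \<and> i \<in> J \<and> s \<noteq> 0 \<and>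
        (\<exists>s1\<in>{-1, 1}. x(j := x j + s1) \<in> Y \<and> s = s1 * sgn (g (x(j := x j + s1)) i - g x i))}"

definition global_interaction_graph ::
  "'j set \<Rightarrow> ('j \<Rightarrow> int) set \<Rightarrow> (('j \<Rightarrow> int) \<Rightarrow> ('j \<Rightarrow> int)) \<Rightarrow> ('j, 'j signed_arc) pre_digraph" where
  "global_interaction_graph J Y g =
     signed_digraph J (\<Union>x\<in>Y. arcs (local_interaction_graph J Y g x))"

text \<open>
  The library's notion of cycle is that of an elementary directed cycle given as a nonempty list
  of arcs, and it admits loops.
\<close>

definition cycle_sign :: "'j signed_arc list \<Rightarrow> int" where
  "cycle_sign p = prod_list (map arc_sign p)"

definition has_positive_cycle :: "('j, 'j signed_arc) pre_digraph \<Rightarrow> bool" where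
  "has_positive_cycle G \<longleftrightarrow> (\<exists>p. pre_digraph.cycle G p \<and> cycle_sign p = 1)"

definition has_negative_cycle :: "('j, 'j signed_arc) pre_digraph \<Rightarrow> bool" where
  "has_negative_cycle G \<longleftrightarrow> (\<exists>p. pre_digraph.cycle G p \<and> cycle_sign p = -1)"

end

(* A level k = 1, ..., m i of the i-th component of X becomes the Boolean vertex (i, k). An arc from j
   to i of G_f changes f_i across some level l, so it lifts to an arc from (j, k) to (i, l) of the same
   sign, for any k: it suffices to start from a y with the right row sums whose entry (j, k) can move
   in the required direction. On an elementary cycle every vertex i is entered by one arc and left by
   one arc; taking the level that the entering arc crosses as the second coordinate of the vertex over
   i makes the lifted arcs close up. For a local cycle one y serves all arcs, because the conditions
   on it concern different rows. *)

theory Submission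
  imports Defs "HOL-Library.Multiset"
begin

section \<open>Elementary cycles as lists of signed arcs\<close>

lemma tl_awalk_verts_signed_digraph:
  assumes "pre_digraph.cas (signed_digraph J E) u p v"
  shows "tl (pre_digraph.awalk_verts (signed_digraph J E) u p) = map (\<lambda>e. snd (snd e)) p"
  using pre_digraph.awalk_verts_conv'[OF assms] by (simp add: signed_digraph_def)

lemma cas_signed_digraph_Cons:
  "pre_digraph.cas (signed_digraph J E) u (e # p) v \<longleftrightarrow>
     fst e = u \<and> pre_digraph.cas (signed_digraph J E) (snd (snd e)) p v"
  by (simp add: pre_digraph.cas.simps signed_digraph_def)

text \<open>Both sides count the vertices visited by the walk, once as the tails followed by the end
  \<open>v\<close> and once as the start \<open>u\<close> followed by the heads. On a closed walk
  the end terms cancel, so tails and heads agree as multisets.\<close>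

lemma cas_signed_digraph_mset:
  assumes "pre_digraph.cas (signed_digraph J E) u p v"
  shows "add_mset v (image_mset fst (mset p)) =
    add_mset u (image_mset (\<lambda>e. snd (snd e)) (mset p))"
  using assms
proof (induction p arbitrary: u)
  case Nil
  then show ?case by (simp add: pre_digraph.cas.simps)
next
  case (Cons e p)
  then show ?case
    by (simp add: cas_signed_digraph_Cons)
qed

text \<open>Elementarity of a cycle concerns the vertex list without its first entry, that is, the
  heads. The tails are a rearrangement of the heads because the walk is closed, so they are distinct
  as well.\<close>

lemma cycle_signed_digraphD:
  assumes "pre_digraph.cycle (signed_digraph J E) p"
  shows "set p \<subseteq> E" "distinct (map (\<lambda>e. snd (snd e)) p)" "distinct (map fst p)"
proof -
  obtain u where walk: "set p \<subseteq> E" "pre_digraph.cas (signed_digraph J E) u p u"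
    and d: "distinct (tl (pre_digraph.awalk_verts (signed_digraph J E) u p))"
    using assms
    by (auto simp: pre_digraph.cycle_def pre_digraph.awalk_def signed_digraph_def)
  show "set p \<subseteq> E" by fact
  show heads: "distinct (map (\<lambda>e. snd (snd e)) p)"
    using d tl_awalk_verts_signed_digraph[OF walk(2)] by simp
  have "mset (map fst p) = mset (map (\<lambda>e. snd (snd e)) p)"
    using cas_signed_digraph_mset[OF walk(2)] by simp
  then show "distinct (map fst p)"
    using heads mset_eq_imp_distinct_iff by blast
qed

lemma cas_signed_digraph_map:
  assumes "pre_digraph.cas (signed_digraph J E) u p v"
  shows "pre_digraph.cas (signed_digraph J' E') (h u) (map (\<lambda>(j, s, i). (h j, s, h i)) p) (h v)"
  using assms
  by (induction p arbitrary: u)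
     (auto simp: pre_digraph.cas.simps signed_digraph_def)

text \<open>The list of heads is mapped through \<open>h\<close>, so injectivity keeps its entries
  distinct. The later use is \<open>h i = (i, k i)\<close>, which copies a cycle on
  \<open>{1..n}\<close> into the Boolean index set.\<close>

lemma cycle_signed_digraph_map:
  assumes cyc: "pre_digraph.cycle (signed_digraph J E) p"
    and h: "inj h" "h ` J \<subseteq> J'"
    and arcs: "\<And>j s i. (j, s, i) \<in> set p \<Longrightarrow> (h j, s, h i) \<in> E'"
  shows "pre_digraph.cycle (signed_digraph J' E') (map (\<lambda>(j, s, i). (h j, s, h i)) p)" (is "pre_digraph.cycle _ ?q")
proof -
  obtain u where u: "u \<in> J" "pre_digraph.cas (signed_digraph J E) u p u" "p \<noteq> []"
    using cyc by (auto simp: pre_digraph.cycle_def pre_digraph.awalk_def signed_digraph_def)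
  have cas: "pre_digraph.cas (signed_digraph J' E') (h u) ?q (h u)"
    using cas_signed_digraph_map[OF u(2)] .
  have "map (\<lambda>e. snd (snd e)) ?q = map h (map (\<lambda>e. snd (snd e)) p)"
    by (auto split: prod.splits)
  then have "distinct (map (\<lambda>e. snd (snd e)) ?q)"
    using cycle_signed_digraphD(2)[OF cyc] h(1) by (metis distinct_map inj_on_subset subset_UNIV)
  then have "distinct (tl (pre_digraph.awalk_verts (signed_digraph J' E') (h u) ?q))"
    using tl_awalk_verts_signed_digraph[OF cas] by simp
  moreover have "set ?q \<subseteq> E'"
    using arcs by auto
  ultimately show ?thesis
    using u h(2) cas unfolding pre_digraph.cycle_def pre_digraph.awalk_def
    by (intro exI[of _ "h u"]) (auto simp: signed_digraph_def)
qed

lemma cycle_sign_map: "cycle_sign (map (\<lambda>(j, s, i). (h j, s, h i)) p) = cycle_sign p"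
proof -
  have "arc_sign \<circ> (\<lambda>(j, s, i). (h j, s, h i)) = arc_sign"
    by (auto simp: arc_sign_def)
  then show ?thesis by (simp add: cycle_sign_def)
qed

text \<open>Turns data \<open>l\<close> attached to the arcs of a cycle into data attached to
  vertices. With \<open>g\<close> the head it yields one level per vertex, with \<open>g\<close> the
  tail one direction per vertex; \<open>d\<close> is the value off the cycle.\<close>

lemma distinct_map_factor:
  assumes "distinct (map g p)"
  obtains \<phi> where "\<And>e. e \<in> set p \<Longrightarrow> \<phi> (g e) = l e"
    "\<And>i. i \<notin> g ` set p \<Longrightarrow> \<phi> i = d"
proof
  have "inj_on g (set p)" using assms by (simp add: distinct_map)
  then show "(\<lambda>i. if i \<in> g ` set p then l (inv_into (set p) g i) else d) (g e) = l e"
    if "e \<in> set p" for e using that by simp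
  show "(\<lambda>i. if i \<in> g ` set p then l (inv_into (set p) g i) else d) i = d"
    if "i \<notin> g ` set p" for i using that by simp
qed

section \<open>Row sums of Boolean vectors and injectivity of the encoding\<close>

text \<open>On \<open>bool_space\<close> this is the composition of \<open>psi\<close> with the
  inverse of \<open>beta\<close>, given explicitly. The restriction makes the result an element of
  \<open>mv_space\<close>.\<close>

definition row_sums :: "nat \<Rightarrow> (nat \<Rightarrow> nat) \<Rightarrow> (nat \<times> nat \<Rightarrow> int) \<Rightarrow> (nat \<Rightarrow> int)" where
  "row_sums n m y = restrict (\<lambda>i. \<Sum>k = 1..m i. y (i, k)) {1..n}"

lemma psi_eq_beta_row_sums: "psi n m y = beta n m (row_sums n m y)"
  by (auto simp: psi_def beta_def row_sums_def bool_index_def fun_eq_iff restrict_def)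

lemma row_sums_in_mv_space:
  assumes "y \<in> bool_space n m"
  shows "row_sums n m y \<in> mv_space n m"
  unfolding mv_space_def
proof (rule PiE_I)
  fix i assume i: "i \<in> {1..n}"
  have "y (i, k) \<in> {0, 1}" if "k \<in> {1..m i}" for k
    using assms i that by (force simp: bool_space_def bool_index_def PiE_iff)
  then have "0 \<le> y (i, k) \<and> y (i, k) \<le> 1" if "k \<in> {1..m i}" for k
    using that by force
  then have "0 \<le> (\<Sum>k = 1..m i. y (i, k))" "(\<Sum>k = 1..m i. y (i, k)) \<le> (\<Sum>k = 1..m i. 1)"
    by (blast intro: sum_nonneg, blast intro: sum_mono)
  then show "row_sums n m y i \<in> {0..int (m i)}"
    using i by (simp add: row_sums_def)
qed (auto simp: row_sums_def)

lemma row_sums_update: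
  assumes "j \<in> {1..n}" "k \<in> {1..m j}"
  shows "row_sums n m (y((j, k) := y (j, k) + t)) = (row_sums n m y)(j := row_sums n m y j + t)"
proof -
  have "(\<Sum>l = 1..m i. (y((j, k) := y (j, k) + t)) (i, l)) =
      (\<Sum>l = 1..m i. y (i, l)) + (if i = j then t else 0)" for i
  proof -
    have "(\<Sum>l = 1..m i. (y((j, k) := y (j, k) + t)) (i, l)) =
        (\<Sum>l = 1..m i. y (i, l) + (if l = k then if i = j then t else 0 else 0))"
      by (intro sum.cong) auto
    then show ?thesis
      using assms by (auto simp: sum.distrib)
  qed
  then show ?thesis
    using assms by (auto simp: row_sums_def fun_eq_iff)
qed

lemma inj_on_beta: "inj_on (beta n m) (mv_space n m)"
proof (rule inj_onI)
  fix x x' assume x: "x \<in> mv_space n m" "x' \<in> mv_space n m" and eq: "beta n m x = beta n m x'"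
  have le: "u i \<le> v i" if "u \<in> mv_space n m" "v \<in> mv_space n m" "beta n m u = beta n m v" "i \<in> {1..n}"
    for u v i
  proof (rule ccontr)
    assume "\<not> u i \<le> v i"
    moreover have "0 \<le> v i" "u i \<le> int (m i)"
      using that by (auto simp: mv_space_def PiE_iff)
    \<comment> \<open>The level \<open>u i\<close> separates the two codes. It is a legitimate index
      because \<open>u i > v i\<close> and \<open>v i\<close> is nonnegative, hence
      \<open>u i\<close> is at least 1.\<close>
    ultimately have "beta n m u (i, nat (u i)) = 1" "beta n m v (i, nat (u i)) = 0"
      using that(4) by (auto simp: beta_def bool_index_def)
    then show False using that(3) by simp
  qed
  show "x = x'"
    using x[unfolded mv_space_def]
    by (rule PiE_ext) (rule antisym[OF le[OF x eq] le[OF x(2,1) eq[symmetric]]])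
qed

section \<open>Boolean vectors with prescribed row sums and a movable entry in each row\<close>

text \<open>\<open>S\<close> is the set of ones in a row and \<open>k\<close> the entry to be moved
  by \<open>t\<close>. Moving up needs \<open>k\<close> outside \<open>S\<close>, for which there is
  room since \<open>a\<close> is below \<open>card A\<close>; moving down needs \<open>k\<close> in
  \<open>S\<close>, which is possible since \<open>a\<close> is positive.\<close>

lemma exists_subset_with_card:
  assumes "finite A" "k \<in> A" "\<bar>t\<bar> \<le> (1::int)" "int a + t \<in> {0..int (card A)}" "a \<le> card A"
  shows "\<exists>S\<subseteq>A. card S = a \<and> of_bool (k \<in> S) + t \<in> {0, 1 :: int}"
proof -
  consider "t = 0" | "t = 1" | "t = -1" using assms(3) by linarith
  then show ?thesis
  proof cases
    case 1
    then show ?thesis by (auto intro: obtain_subset_with_card_n[OF assms(5)])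
  next
    case 2
    then have "a \<le> card (A - {k})" using assms by simp
    then obtain S where "S \<subseteq> A - {k}" "card S = a" by (rule obtain_subset_with_card_n)
    then show ?thesis using 2 by (intro exI[of _ S]) auto
  next
    case 3
    then have "a - 1 \<le> card (A - {k})" using assms by simp
    then obtain S where S: "S \<subseteq> A - {k}" "card S = a - 1" by (rule obtain_subset_with_card_n)
    then have "finite S" "k \<notin> S" using assms(1) finite_subset[of S A] by blast+
    then have "card (insert k S) = a" using S(2) assms(4) 3 by simp
    then show ?thesis using S(1) assms(2) 3 by (intro exI[of _ "insert k S"]) auto
  qed
qed

text \<open>The value \<open>t i = 0\<close> leaves row \<open>i\<close> unconstrained.\<close>

lemma exists_bool_vector:
  assumes x: "x \<in> mv_space n m"
    and k: "\<And>i. i \<in> {1..n} \<Longrightarrow> k i \<in> {1..m i}"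
    and t: "\<And>i. i \<in> {1..n} \<Longrightarrow> \<bar>t i\<bar> \<le> 1 \<and> x i + t i \<in> {0..int (m i)}"
  obtains y where "y \<in> bool_space n m" "row_sums n m y = x"
    "\<And>i. i \<in> {1..n} \<Longrightarrow> y (i, k i) + t i \<in> {0, 1}"
proof -
  have xi: "x i \<in> {0..int (m i)}" if "i \<in> {1..n}" for i
    using x that by (auto simp: mv_space_def PiE_iff)
  have "\<exists>S\<subseteq>{1..m i}. card S = nat (x i) \<and> of_bool (k i \<in> S) + t i \<in> {0, 1 :: int}"
    if i: "i \<in> {1..n}" for i
    by (rule exists_subset_with_card) (use k[OF i] t[OF i] xi[OF i] in auto)
  \<comment> \<open>The requirements on different rows are independent, so the rows can be filled
    one at a time.\<close>
  then obtain S where S: "\<And>i. i \<in> {1..n} \<Longrightarrow> S i \<subseteq> {1..m i}"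
      "\<And>i. i \<in> {1..n} \<Longrightarrow> card (S i) = nat (x i)"
      "\<And>i. i \<in> {1..n} \<Longrightarrow> of_bool (k i \<in> S i) + t i \<in> {0, 1 :: int}"
    by metis
  define y :: "nat \<times> nat \<Rightarrow> int"
    where "y = restrict (\<lambda>(i, l). of_bool (l \<in> S i)) (bool_index n m)"
  have "(\<Sum>l = 1..m i. y (i, l)) = x i" if i: "i \<in> {1..n}" for i
  proof -
    have "(\<Sum>l = 1..m i. y (i, l)) = (\<Sum>l\<in>{1..m i}. of_bool (l \<in> S i))"
      using i by (intro sum.cong) (auto simp: y_def bool_index_def)
    also have "\<dots> = int (card ({1..m i} \<inter> S i))"
      by simp
    also have "{1..m i} \<inter> S i = S i"
      using S(1)[OF i] by blast
    finally show ?thesis using S(2)[OF i] xi[OF i] by simp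
  qed
  then have "row_sums n m y = x"
    using x by (auto simp: row_sums_def mv_space_def fun_eq_iff PiE_def extensional_def)
  moreover have "y \<in> bool_space n m"
    by (auto simp: y_def bool_space_def)
  moreover have "y (i, k i) + t i \<in> {0, 1}" if "i \<in> {1..n}" for i
    using S(3)[OF that] k[OF that] that by (simp add: y_def bool_index_def)
  ultimately show ?thesis using that by blast
qed

section \<open>Lifting a single arc\<close>

text \<open>Keeps the witnesses of an arc of the local graph: the direction \<open>t\<close> of the
  move and a level \<open>l\<close> at which the codes of the two values of the \<open>i\<close>-th
  component differ. The lower inequality is strict and the upper one is not because
  \<open>beta\<close> has entry 1 exactly from level \<open>l\<close> upwards.\<close>

definition crosses_level ::
  "nat \<Rightarrow> (nat \<Rightarrow> nat) \<Rightarrow> ((nat \<Rightarrow> int) \<Rightarrow> (nat \<Rightarrow> int)) \<Rightarrow> (nat \<Rightarrow> int) \<Rightarrow> int \<Rightarrow> nat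
    \<Rightarrow> nat signed_arc \<Rightarrow> bool" where
  "crosses_level n m f x t l = (\<lambda>(j, s, i).
     j \<in> {1..n} \<and> i \<in> {1..n} \<and> l \<in> {1..m i} \<and> t \<in> {-1, 1} \<and> x(j := x j + t) \<in> mv_space n m \<and>
     s = t * sgn (f (x(j := x j + t)) i - f x i) \<and>
     min (f x i) (f (x(j := x j + t)) i) < int l \<and> int l \<le> max (f x i) (f (x(j := x j + t)) i))"

lemma arc_crosses_level:
  assumes f: "f \<in> mv_space n m \<rightarrow> mv_space n m" and x: "x \<in> mv_space n m"
    and e: "e \<in> arcs (local_interaction_graph {1..n} (mv_space n m) f x)"
  shows "\<exists>t l. crosses_level n m f x t l e"
proof -
  obtain j s i where e: "e = (j, s, i)"
    by (rule prod_cases3)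
  obtain t where w: "j \<in> {1..n}" "i \<in> {1..n}" "s \<noteq> 0" "t \<in> {-1, 1}"
      "x(j := x j + t) \<in> mv_space n m" "s = t * sgn (f (x(j := x j + t)) i - f x i)"
    using assms(3)
    unfolding e local_interaction_graph_def signed_digraph_def pre_digraph.select_convs mem_Collect_eq
    by blast
  let ?x' = "x(j := x j + t)"
  have "f x \<in> mv_space n m" "f ?x' \<in> mv_space n m"
    using f x w by auto
  then have "f x i \<in> {0..int (m i)}" "f ?x' i \<in> {0..int (m i)}"
    using w(2) unfolding mv_space_def PiE_iff by blast+
  moreover have "f x i \<noteq> f ?x' i"
    using w by auto
  \<comment> \<open>The larger of two distinct values is always a crossed level; it is at least 1
    because the smaller one is nonnegative.\<close>
  ultimately have "crosses_level n m f x t (nat (max (f x i) (f ?x' i))) e"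
    using w unfolding e crosses_level_def by (auto simp: max_def min_def)
  then show ?thesis by blast
qed

text \<open>\<open>F\<close> depends on a Boolean vector only through its row sums. Changing entry
  \<open>(j, k)\<close> by \<open>t\<close> changes the \<open>j\<close>-th row sum by
  \<open>t\<close>, so \<open>F\<close> responds as \<open>f\<close> does to the original move. The
  last hypothesis keeps the changed vector Boolean.\<close>

lemma crosses_level_lift:
  assumes f: "f \<in> mv_space n m \<rightarrow> mv_space n m"
    and F: "F = beta n m \<circ> f \<circ> inv_into (mv_space n m) (beta n m) \<circ> psi n m"
    and y: "y \<in> bool_space n m"
    and cross: "crosses_level n m f (row_sums n m y) t l (j, s, i)"
    and k: "k \<in> {1..m j}" "y (j, k) + t \<in> {0, 1}"
  shows "((j, k), s, (i, l)) \<in> arcs (local_interaction_graph (bool_index n m) (bool_space n m) F y)"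
proof -
  let ?x = "row_sums n m y" and ?y' = "y((j, k) := y (j, k) + t)"
  let ?x' = "?x(j := ?x j + t)"
  have F_beta: "F z = beta n m (f (row_sums n m z))" if "z \<in> bool_space n m" for z
    using row_sums_in_mv_space[OF that]
    by (simp add: F psi_eq_beta_row_sums inv_into_f_f[OF inj_on_beta])
  note c = cross[unfolded crosses_level_def prod.case]
  have jk: "(j, k) \<in> bool_index n m" and il: "(i, l) \<in> bool_index n m"
    using c k by (auto simp: bool_index_def)
  have y': "?y' \<in> bool_space n m"
    using y jk k(2) by (auto simp: bool_space_def PiE_iff extensional_def)
  have "row_sums n m ?y' = ?x'"
    using c k by (intro row_sums_update) auto
  \<comment> \<open>As \<open>l\<close> separates the two values of the \<open>i\<close>-th
    component of \<open>f\<close>, the Boolean coordinate \<open>(i, l)\<close> flips in the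
    direction in which that component moves.\<close>
  then have "sgn (F ?y' (i, l) - F y (i, l)) = sgn (f ?x' i - f ?x i)"
    using c il by (auto simp: F_beta[OF y] F_beta[OF y'] beta_def sgn_if min_def max_def split: if_splits)
  moreover have "s \<noteq> 0"
    using c by (auto simp: sgn_if)
  ultimately show ?thesis
    using c jk il y'
    by (auto simp: local_interaction_graph_def signed_digraph_def intro!: bexI[of _ t])
qed

section \<open>Lifting cycles\<close>

text \<open>The base point \<open>x e\<close> may vary with the arc and the target arc set
  \<open>E'\<close> is left open, so that the same choice of levels serves local and global
  cycles.\<close>

lemma cycle_lift:
  assumes m: "\<forall>i\<in>{1..n}. m i \<ge> 1"
    and cyc: "pre_digraph.cycle (signed_digraph {1..n} E) p"
    and cross: "\<And>e. e \<in> set p \<Longrightarrow> crosses_level n m f (x e) (t e) (l e) e"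
  obtains k where "\<And>i. i \<in> {1..n} \<Longrightarrow> k i \<in> {1..m i}"
    "\<And>e. e \<in> set p \<Longrightarrow> crosses_level n m f (x e) (t e) (k (snd (snd e))) e"
    "\<And>E'. (\<And>j s i. (j, s, i) \<in> set p \<Longrightarrow> ((j, k j), s, (i, k i)) \<in> E') \<Longrightarrow>
      \<exists>q. pre_digraph.cycle (signed_digraph (bool_index n m) E') q \<and> cycle_sign q = cycle_sign p"
proof -
  \<comment> \<open>Distinct heads mean that each vertex of the cycle is entered by only one arc,
    whose level it receives. Off the cycle level 1 exists since every \<open>m i\<close> is at least
    1.\<close>
  obtain k where k: "\<And>e. e \<in> set p \<Longrightarrow> k (snd (snd e)) = l e"
      "\<And>i. i \<notin> (\<lambda>e. snd (snd e)) ` set p \<Longrightarrow> k i = 1"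
    using distinct_map_factor[OF cycle_signed_digraphD(2)[OF cyc], where l = l and d = 1] by blast
  have k_range: "k i \<in> {1..m i}" if "i \<in> {1..n}" for i
  proof (cases "i \<in> (\<lambda>e. snd (snd e)) ` set p")
    case True
    then show ?thesis using cross k(1) by (fastforce simp: crosses_level_def)
  next
    case False
    then show ?thesis using k(2) m that by auto
  qed
  show ?thesis
  proof
    show "k i \<in> {1..m i}" if "i \<in> {1..n}" for i using k_range[OF that] .
    show "crosses_level n m f (x e) (t e) (k (snd (snd e))) e" if "e \<in> set p" for e
      using cross[OF that] k(1)[OF that] by simp
    show "\<exists>q. pre_digraph.cycle (signed_digraph (bool_index n m) E') q \<and> cycle_sign q = cycle_sign p"
      if "\<And>j s i. (j, s, i) \<in> set p \<Longrightarrow> ((j, k j), s, (i, k i)) \<in> E'" for E'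
    proof (intro exI conjI)
      show "pre_digraph.cycle (signed_digraph (bool_index n m) E')
          (map (\<lambda>(j, s, i). ((j, k j), s, (i, k i))) p)"
        by (rule cycle_signed_digraph_map[OF cyc, where h = "\<lambda>i. (i, k i)"])
           (use that k_range in \<open>auto simp: bool_index_def inj_def\<close>)
    qed (rule cycle_sign_map)
  qed
qed

lemma local_cycle_lift:
  assumes m: "\<forall>i\<in>{1..n}. m i \<ge> 1"
    and f: "f \<in> mv_space n m \<rightarrow> mv_space n m"
    and F: "F = beta n m \<circ> f \<circ> inv_into (mv_space n m) (beta n m) \<circ> psi n m"
    and x: "x \<in> mv_space n m"
    and cyc: "pre_digraph.cycle (local_interaction_graph {1..n} (mv_space n m) f x) p"
    and sgn: "cycle_sign p = s"
  shows "\<exists>y\<in>bool_space n m. psi n m y = beta n m x \<and>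
    (\<exists>q. pre_digraph.cycle (local_interaction_graph (bool_index n m) (bool_space n m) F y) q \<and>
      cycle_sign q = s)"
proof -
  note cyc' = cyc[unfolded local_interaction_graph_def]
  have "set p \<subseteq> arcs (local_interaction_graph {1..n} (mv_space n m) f x)"
    using cycle_signed_digraphD(1)[OF cyc'] by (simp add: local_interaction_graph_def signed_digraph_def)
  then have "\<forall>e\<in>set p. \<exists>t l. crosses_level n m f x t l e"
    using arc_crosses_level[OF f x] by blast
  then obtain t l where "\<And>e. e \<in> set p \<Longrightarrow> crosses_level n m f x (t e) (l e) e"
    by metis
  from cycle_lift[OF m cyc' this] obtain k where k: "\<And>i. i \<in> {1..n} \<Longrightarrow> k i \<in> {1..m i}"
    "\<And>e. e \<in> set p \<Longrightarrow> crosses_level n m f x (t e) (k (snd (snd e))) e"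
    "\<And>E'. (\<And>j s i. (j, s, i) \<in> set p \<Longrightarrow> ((j, k j), s, (i, k i)) \<in> E') \<Longrightarrow>
      \<exists>q. pre_digraph.cycle (signed_digraph (bool_index n m) E') q \<and> cycle_sign q = cycle_sign p"
    by blast
  \<comment> \<open>Distinct tails mean that each row is asked to move in at most one direction;
    rows off the cycle get 0. This is what lets a single \<open>y\<close> serve all arcs.\<close>
  obtain d where d: "\<And>e. e \<in> set p \<Longrightarrow> d (fst e) = t e" "\<And>i. i \<notin> fst ` set p \<Longrightarrow> d i = 0"
    using distinct_map_factor[OF cycle_signed_digraphD(3)[OF cyc'], where l = t and d = 0] by blast
  have d_range: "\<bar>d i\<bar> \<le> 1 \<and> x i + d i \<in> {0..int (m i)}" if i: "i \<in> {1..n}" for i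
  proof (cases "i \<in> fst ` set p")
    case True
    then obtain e where e: "e \<in> set p" "i = fst e" by blast
    \<comment> \<open>The range condition on row \<open>i\<close> is read off from the neighbouring
      point, which lies in \<open>mv_space\<close>, at its changed coordinate.\<close>
    have "t e \<in> {-1, 1}" "x(i := x i + t e) \<in> mv_space n m"
      using k(2)[OF e(1)] e(2) by (auto simp: crosses_level_def)
    then have "\<bar>t e\<bar> \<le> 1" "(x(i := x i + t e)) i \<in> {0..int (m i)}"
      using i unfolding mv_space_def PiE_iff by (auto, fastforce+)
    then show ?thesis using d(1)[OF e(1)] e(2) by simp
  next
    case False
    then show ?thesis using d(2) x i by (auto simp: mv_space_def PiE_iff)
  qed
  obtain y where y: "y \<in> bool_space n m" "row_sums n m y = x"
      "\<And>i. i \<in> {1..n} \<Longrightarrow> y (i, k i) + d i \<in> {0, 1}"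
    using exists_bool_vector[OF x k(1) d_range] by blast
  have "((j, k j), s, (i, k i)) \<in> arcs (local_interaction_graph (bool_index n m) (bool_space n m) F y)"
    if e: "(j, s, i) \<in> set p" for j s i
  proof (rule crosses_level_lift[OF f F y(1)])
    show c: "crosses_level n m f (row_sums n m y) (t (j, s, i)) (k i) (j, s, i)"
      using k(2)[OF e] y(2) by simp
    then have "j \<in> {1..n}" by (simp add: crosses_level_def)
    then show "k j \<in> {1..m j}" "y (j, k j) + t (j, s, i) \<in> {0, 1}"
      using k(1) y(3)[of j] d(1)[OF e] by auto
  qed
  from k(3)[OF this] show ?thesis
    using y(1,2) sgn psi_eq_beta_row_sums
    by (intro bexI[of _ y]) (auto simp: local_interaction_graph_def signed_digraph_def)
qed

lemma global_cycle_lift: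
  assumes m: "\<forall>i\<in>{1..n}. m i \<ge> 1"
    and f: "f \<in> mv_space n m \<rightarrow> mv_space n m"
    and F: "F = beta n m \<circ> f \<circ> inv_into (mv_space n m) (beta n m) \<circ> psi n m"
    and cyc: "pre_digraph.cycle (global_interaction_graph {1..n} (mv_space n m) f) p"
    and sgn: "cycle_sign p = s"
  shows "\<exists>q. pre_digraph.cycle (global_interaction_graph (bool_index n m) (bool_space n m) F) q \<and>
    cycle_sign q = s"
proof -
  note cyc' = cyc[unfolded global_interaction_graph_def]
  have "\<forall>e\<in>set p. \<exists>x t l. x \<in> mv_space n m \<and> crosses_level n m f x t l e"
    using cycle_signed_digraphD(1)[OF cyc'] arc_crosses_level[OF f] by blast
  then obtain x t l where x: "\<And>e. e \<in> set p \<Longrightarrow> x e \<in> mv_space n m"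
    and "\<And>e. e \<in> set p \<Longrightarrow> crosses_level n m f (x e) (t e) (l e) e"
    by metis
  from cycle_lift[OF m cyc' this(2)] obtain k where k: "\<And>i. i \<in> {1..n} \<Longrightarrow> k i \<in> {1..m i}"
    "\<And>e. e \<in> set p \<Longrightarrow> crosses_level n m f (x e) (t e) (k (snd (snd e))) e"
    "\<And>E'. (\<And>j s i. (j, s, i) \<in> set p \<Longrightarrow> ((j, k j), s, (i, k i)) \<in> E') \<Longrightarrow>
      \<exists>q. pre_digraph.cycle (signed_digraph (bool_index n m) E') q \<and> cycle_sign q = cycle_sign p"
    by blast
  have "((j, k j), s, (i, k i)) \<in>
      (\<Union>y\<in>bool_space n m. arcs (local_interaction_graph (bool_index n m) (bool_space n m) F y))"
    if e: "(j, s, i) \<in> set p" for j s i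
  proof -
    let ?x = "x (j, s, i)" and ?t = "t (j, s, i)"
    have c: "crosses_level n m f ?x ?t (k i) (j, s, i)"
      using k(2)[OF e] by simp
    then have j: "j \<in> {1..n}" and t: "?t \<in> {-1, 1}" and x': "?x(j := ?x j + ?t) \<in> mv_space n m"
      by (auto simp: crosses_level_def)
    have "(?x(j := ?x j + ?t)) j \<in> {0..int (m j)}"
      using x' j unfolding mv_space_def PiE_iff by blast
    \<comment> \<open>In the global graph each arc has its own base point and may have its own
      \<open>y\<close>, so only the row \<open>j\<close> of its tail has to be movable. The levels
      \<open>k\<close> are still common to all arcs, which makes the lifted arcs fit
      together.\<close>
    then have "\<bar>((\<lambda>_. 0)(j := ?t)) i'\<bar> \<le> 1 \<and> ?x i' + ((\<lambda>_. 0)(j := ?t)) i' \<in> {0..int (m i')}"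
      if "i' \<in> {1..n}" for i'
      using t x[OF e] that by (auto simp: mv_space_def PiE_iff)
    then obtain y where y: "y \<in> bool_space n m" "row_sums n m y = ?x"
        "\<And>i. i \<in> {1..n} \<Longrightarrow> y (i, k i) + ((\<lambda>_. 0)(j := ?t)) i \<in> {0, 1}"
      using exists_bool_vector[OF x[OF e] k(1)] by blast
    then have "((j, k j), s, (i, k i)) \<in>
        arcs (local_interaction_graph (bool_index n m) (bool_space n m) F y)"
      using crosses_level_lift[OF f F y(1), of ?t "k i" j s i "k j"] c k(1)[OF j] y(3)[OF j] by simp
    then show ?thesis using y(1) by blast
  qed
  from k(3)[OF this] show ?thesis by (simp add: sgn global_interaction_graph_def)
qed

theorem theorem1:
  fixes n :: nat and m :: "nat \<Rightarrow> nat"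
    and f :: "(nat \<Rightarrow> int) \<Rightarrow> (nat \<Rightarrow> int)"
    and F :: "(nat \<times> nat \<Rightarrow> int) \<Rightarrow> (nat \<times> nat \<Rightarrow> int)"
  assumes m_ge_1: "\<forall>i\<in>{1..n}. m i \<ge> 1"
    and f_maps: "f \<in> mv_space n m \<rightarrow> mv_space n m"
    and F_eq: "F = beta n m \<circ> f \<circ> inv_into (mv_space n m) (beta n m) \<circ> psi n m"
  shows
    "(\<forall>x\<in>mv_space n m.
        (has_positive_cycle (local_interaction_graph {1..n} (mv_space n m) f x) \<longrightarrow>
          (\<exists>y\<in>bool_space n m. psi n m y = beta n m x \<and>
             has_positive_cycle (local_interaction_graph (bool_index n m) (bool_space n m) F y))) \<and>
        (has_negative_cycle (local_interaction_graph {1..n} (mv_space n m) f x) \<longrightarrow>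
          (\<exists>y\<in>bool_space n m. psi n m y = beta n m x \<and>
             has_negative_cycle (local_interaction_graph (bool_index n m) (bool_space n m) F y)))) \<and>
     (has_positive_cycle (global_interaction_graph {1..n} (mv_space n m) f) \<longrightarrow>
        has_positive_cycle (global_interaction_graph (bool_index n m) (bool_space n m) F)) \<and>
     (has_negative_cycle (global_interaction_graph {1..n} (mv_space n m) f) \<longrightarrow>
        has_negative_cycle (global_interaction_graph (bool_index n m) (bool_space n m) F))"
  unfolding has_positive_cycle_def has_negative_cycle_def
  by (intro conjI ballI impI; elim exE conjE;
      rule local_cycle_lift[OF m_ge_1 f_maps F_eq] global_cycle_lift[OF m_ge_1 f_maps F_eq]; assumption)

end
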